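(* Let $T$ and $T_k$, $k\in\mathbb{N}$, be closed, densely defined operators acting in the same complex Banach space $\mathcal{X}$. Let $K\subset\mathbb{C}$ be compact and $\varepsilon>0$. Suppose that i) $\overline{\sigma_{\varepsilon}(T)}\cap K=\overline{\sigma_{\varepsilon}(T)\cap K}\neq\emptyset$; ii) the function $\lambda\mapsto\|(T-\lambda)^{-1}\|$ is non-constant on every non-empty open subset of $\rho(T)$; iii) $T_k$ converges to $T$ in the norm resolvent sense, i.e. there exists $\lambda_0\in\bigcap_{k\in\mathbb{N}}\rho(T_k)\cap\rho(T)$ such that $\|(T_k-\lambda_0)^{-1}-(T-\lambda_0)^{-1}\|\to0$ as $k\to\infty$. Then $$d_{\rm H}\left(\overline{\sigma_{\varepsilon}(T_k)}\cap K,\ \overline{\sigma_{\varepsilon}(T)}\cap K\right)\longrightarrow 0,\qquad k\to\infty.$$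
   Context: For a closed operator $T$ and $\varepsilon>0$, the $\varepsilon$-pseudospectrum is $\sigma_\varepsilon(T):=\{z\in\mathbb{C}: \|(T-z)^{-1}\|>1/\varepsilon\}$, with the convention $\|(T-z)^{-1}\|=\infty$ for $z\in\sigma(T)$; $\rho(T)$ is the resolvent set and $\sigma(T)$ the spectrum. For non-empty compact sets $K_1,K_2\subset\mathbb{C}$ the Hausdorff distance is $d_{\rm H}(K_1,K_2):=\max\{\sup_{z\in K_1}\mathrm{dist}(z,K_2),\ \sup_{z\in K_2}\mathrm{dist}(z,K_1)\}$, where $\mathrm{dist}(z,K_j):=\inf_{w\in K_j}|z-w|$. The convergence of the Hausdorff distances includes the assertion that the sets $\overline{\sigma_\varepsilon(T_k)}\cap K$ are non-empty for all sufficiently large $k$. *)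

theory Defs
  imports "HOL-Analysis.Analysis"
begin

text \<open>The imported libraries have real Banach spaces only.\<close>

class complex_banach = banach +
  fixes scaleC :: "complex \<Rightarrow> 'a \<Rightarrow> 'a"  (infixr "*\<^sub>C" 75)
  assumes scaleC_add_right: "a *\<^sub>C (x + y) = a *\<^sub>C x + a *\<^sub>C y"
    and scaleC_add_left: "(a + b) *\<^sub>C x = a *\<^sub>C x + b *\<^sub>C x"
    and scaleC_scaleC: "a *\<^sub>C b *\<^sub>C x = (a * b) *\<^sub>C x"
    and scaleC_of_real: "complex_of_real r *\<^sub>C x = r *\<^sub>R x"
    and norm_scaleC: "norm (a *\<^sub>C x) = cmod a * norm x"

instantiation complex :: complex_banach
begin

definition scaleC_complex :: "complex \<Rightarrow> complex \<Rightarrow> complex"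
  where "scaleC_complex a x = a * x"

instance
  by standard (auto simp: scaleC_complex_def algebra_simps norm_mult scaleR_conv_of_real)

end

text \<open>An operator in a space is a domain together with a map, whose values outside of the domain
  are irrelevant.\<close>

record 'a operator =
  op_dom :: "'a set"
  op_app :: "'a \<Rightarrow> 'a"

definition linear_operator :: "'a::complex_banach operator \<Rightarrow> bool" where
  "linear_operator T \<longleftrightarrow>
     0 \<in> op_dom T \<and>
     (\<forall>x\<in>op_dom T. \<forall>y\<in>op_dom T.
        x + y \<in> op_dom T \<and> op_app T (x + y) = op_app T x + op_app T y) \<and>
     (\<forall>c. \<forall>x\<in>op_dom T. c *\<^sub>C x \<in> op_dom T \<and> op_app T (c *\<^sub>C x) = c *\<^sub>C op_app T x)"

definition op_graph :: "'a operator \<Rightarrow> ('a \<times> 'a) set" where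
  "op_graph T = {(x, op_app T x) | x. x \<in> op_dom T}"

definition closed_operator :: "'a::complex_banach operator \<Rightarrow> bool" where
  "closed_operator T \<longleftrightarrow> linear_operator T \<and> closed (op_graph T)"

definition densely_defined :: "'a::complex_banach operator \<Rightarrow> bool" where
  "densely_defined T \<longleftrightarrow> closure (op_dom T) = UNIV"

definition op_shift :: "'a::complex_banach operator \<Rightarrow> complex \<Rightarrow> 'a \<Rightarrow> 'a" where
  "op_shift T z x = op_app T x - z *\<^sub>C x"

text \<open>The map \<open>(T - z)\<^sup>-\<^sup>1\<close>; it is meaningful only for \<open>z\<close> in the resolvent set.\<close>

definition resolvent :: "'a::complex_banach operator \<Rightarrow> complex \<Rightarrow> 'a \<Rightarrow> 'a" where
  "resolvent T z = inv_into (op_dom T) (op_shift T z)"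

definition resolvent_set :: "'a::complex_banach operator \<Rightarrow> complex set" where
  "resolvent_set T =
     {z. bij_betw (op_shift T z) (op_dom T) UNIV \<and> bounded_linear (resolvent T z)}"

definition op_spectrum :: "'a::complex_banach operator \<Rightarrow> complex set" where
  "op_spectrum T = - resolvent_set T"

definition resolvent_norm :: "'a::complex_banach operator \<Rightarrow> complex \<Rightarrow> ereal" where
  "resolvent_norm T z = (if z \<in> op_spectrum T then \<infinity> else ereal (onorm (resolvent T z)))"

definition pseudospectrum :: "real \<Rightarrow> 'a::complex_banach operator \<Rightarrow> complex set" where
  "pseudospectrum \<epsilon> T = {z. resolvent_norm T z > ereal (1 / \<epsilon>)}"

text \<open>Only meaningful for non-empty bounded sets: the supremum of an empty or unbounded set of
  reals, and the distance to an empty set, take default values.\<close>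

definition hausdorff_dist :: "complex set \<Rightarrow> complex set \<Rightarrow> real" where
  "hausdorff_dist K L = max (SUP z\<in>K. infdist z L) (SUP z\<in>L. infdist z K)"

end

theory Submission
  imports Defs
begin

text \<open>The norm of \<open>(T\<^sub>k - z\<^sub>k)\<^sup>-\<^sup>1\<close> is controlled by that of \<open>(T - z)\<^sup>-\<^sup>1\<close>, and conversely, up to an error
  that vanishes as \<open>k \<rightarrow> \<infinity>\<close> and \<open>z\<^sub>k \<rightarrow> z\<close>. Hence points of the pseudospectrum of \<open>T\<close> are
  eventually in that of \<open>T\<^sub>k\<close>, and points with \<open>\<parallel>(T - z)\<^sup>-\<^sup>1\<parallel> < 1/\<epsilon>\<close> have a neighbourhood which the
  pseudospectra of \<open>T\<^sub>k\<close> eventually avoid; compactness of \<open>K\<close> makes both uniform. A point with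
  \<open>\<parallel>(T - z)\<^sup>-\<^sup>1\<parallel> = 1/\<epsilon>\<close> outside the closed pseudospectrum would be a local maximum of the resolvent
  norm, which by the maximum principle would be constant around it.\<close>

section \<open>Resolvents\<close>

lemma scaleC_zero_right [simp]: "c *\<^sub>C (0::'a::complex_banach) = 0"
  by (metis norm_eq_zero norm_scaleC mult_zero_right norm_zero)

lemma scaleC_minus_right: "c *\<^sub>C (- x) = - (c *\<^sub>C (x::'a::complex_banach))"
  by (metis add.right_inverse add_eq_0_iff scaleC_add_right scaleC_zero_right)

lemma scaleC_diff_right: "c *\<^sub>C (x - y) = c *\<^sub>C x - c *\<^sub>C (y::'a::complex_banach)"
  by (metis diff_conv_add_uminus scaleC_add_right scaleC_minus_right)

lemma scaleC_zero_left [simp]: "0 *\<^sub>C (x::'a::complex_banach) = 0"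
  by (metis norm_eq_zero norm_scaleC mult_zero_left norm_zero)

lemma scaleC_one [simp]: "1 *\<^sub>C (x::'a::complex_banach) = x"
  using scaleC_of_real [of 1 x] by simp

lemma scaleC_minus_left: "(- c) *\<^sub>C x = - (c *\<^sub>C (x::'a::complex_banach))"
  by (metis add.right_inverse add_eq_0_iff scaleC_add_left scaleC_zero_left)

lemma scaleC_diff_left: "(c - d) *\<^sub>C x = c *\<^sub>C x - d *\<^sub>C (x::'a::complex_banach)"
  by (metis diff_conv_add_uminus scaleC_add_left scaleC_minus_left)

lemma scaleC_sum_left: "(\<Sum>i\<in>I. f i) *\<^sub>C (x::'a::complex_banach) = (\<Sum>i\<in>I. f i *\<^sub>C x)"
  by (induction I rule: infinite_finite_induct) (auto simp: scaleC_add_left)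

lemma scaleC_sum_right: "c *\<^sub>C (\<Sum>i\<in>I. f i) = (\<Sum>i\<in>I. c *\<^sub>C (f i :: 'a::complex_banach))"
  by (induction I rule: infinite_finite_induct) (auto simp: scaleC_add_right)

lemma op_shift_add:
  assumes "linear_operator T" "x \<in> op_dom T" "y \<in> op_dom T"
  shows "x + y \<in> op_dom T" "op_shift T z (x + y) = op_shift T z x + op_shift T z y"
  using assms by (auto simp: linear_operator_def op_shift_def scaleC_add_right)

lemma op_shift_scaleC:
  assumes "linear_operator T" "x \<in> op_dom T"
  shows "c *\<^sub>C x \<in> op_dom T" "op_shift T z (c *\<^sub>C x) = c *\<^sub>C op_shift T z x"
  using assms
  by (auto simp: linear_operator_def op_shift_def scaleC_diff_right scaleC_scaleC mult.commute)

lemma op_shift_shift: "op_shift T z x = op_shift T w x + (w - z) *\<^sub>C x"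
  by (simp add: op_shift_def scaleC_diff_left)

lemma resolvent_in_dom: "z \<in> resolvent_set T \<Longrightarrow> resolvent T z x \<in> op_dom T"
  unfolding resolvent_set_def resolvent_def bij_betw_def by (auto intro: inv_into_into)

lemma op_shift_resolvent: "z \<in> resolvent_set T \<Longrightarrow> op_shift T z (resolvent T z x) = x"
  unfolding resolvent_set_def resolvent_def bij_betw_def by (auto intro: f_inv_into_f)

lemma resolvent_op_shift:
  "z \<in> resolvent_set T \<Longrightarrow> x \<in> op_dom T \<Longrightarrow> resolvent T z (op_shift T z x) = x"
  unfolding resolvent_set_def resolvent_def bij_betw_def by (auto intro: inv_into_f_f)

lemma bounded_linear_resolvent: "z \<in> resolvent_set T \<Longrightarrow> bounded_linear (resolvent T z)"
  by (simp add: resolvent_set_def)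

lemma norm_resolvent_le:
  "z \<in> resolvent_set T \<Longrightarrow> norm (resolvent T z x) \<le> onorm (resolvent T z) * norm x"
  by (simp add: bounded_linear_resolvent onorm)

lemma resolvent_scaleC:
  assumes "linear_operator T" "z \<in> resolvent_set T"
  shows "resolvent T z (c *\<^sub>C x) = c *\<^sub>C resolvent T z x"
  by (metis assms op_shift_scaleC op_shift_resolvent resolvent_in_dom resolvent_op_shift)

text \<open>The lower bound gives injectivity and, once surjectivity is known, bounds the inverse by
  the same constant. A perturbed operator thus requires only an a priori estimate and
  solvability.\<close>

lemma resolvent_set_intro:
  assumes T: "linear_operator T" and "0 \<le> M"
    and bound: "\<And>x. x \<in> op_dom T \<Longrightarrow> norm x \<le> M * norm (op_shift T z x)"
    and surj: "\<And>x. \<exists>y\<in>op_dom T. op_shift T z y = x"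
  shows "z \<in> resolvent_set T" and "onorm (resolvent T z) \<le> M"
proof -
  have inj: "inj_on (op_shift T z) (op_dom T)"
  proof (rule inj_onI)
    fix x y assume xy: "x \<in> op_dom T" "y \<in> op_dom T" "op_shift T z x = op_shift T z y"
    \<comment> \<open>Linearity speaks only of sums and scalar multiples, so the difference of
      \<open>x\<close> and \<open>y\<close> is formed with the scalar -1.\<close>
    have y': "- y \<in> op_dom T" "op_shift T z (- y) = - op_shift T z y"
      using op_shift_scaleC [OF T xy(2), where c = "-1"] by (auto simp: scaleC_minus_left)
    have "norm (x + - y) \<le> M * norm (op_shift T z (x + - y))"
      by (rule bound) (rule op_shift_add [OF T xy(1) y'(1)])
    also have "op_shift T z (x + - y) = 0"
      using op_shift_add(2) [OF T xy(1) y'(1)] y'(2) xy(3) by simp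
    finally show "x = y" by simp
  qed
  have im: "op_shift T z ` op_dom T = UNIV"
    using surj by (metis UNIV_eq_I image_eqI)
  define R where "R = resolvent T z"
  have R: "R x \<in> op_dom T" "op_shift T z (R x) = x" for x
    unfolding R_def resolvent_def using im by (auto intro: inv_into_into f_inv_into_f)
  have R': "R (op_shift T z x) = x" if "x \<in> op_dom T" for x
    unfolding R_def resolvent_def using inj that by simp
  have nR: "norm (R x) \<le> M * norm x" for x
    using bound [OF R(1), of x] R(2) by simp
  have "bounded_linear R"
  proof (rule bounded_linear_intro)
    show "R (x + y) = R x + R y" for x y
      by (metis R R' T op_shift_add)
    show "R (r *\<^sub>R x) = r *\<^sub>R R x" for r x
      by (metis R R' T op_shift_scaleC scaleC_of_real)
    show "norm (R x) \<le> norm x * M" for x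
      using nR by (simp add: mult.commute)
  qed
  then show "z \<in> resolvent_set T"
    using inj im by (simp add: resolvent_set_def bij_betw_def R_def)
  show "onorm (resolvent T z) \<le> M"
    using nR \<open>0 \<le> M\<close> by (auto intro: onorm_bound simp: R_def)
qed

text \<open>Passing to the complement removes the value \<open>\<infinity>\<close> on the spectrum,
  so that all later estimates concern real operator norms.\<close>

lemma not_in_pseudospectrum_iff:
  "z \<notin> pseudospectrum \<epsilon> T \<longleftrightarrow> z \<in> resolvent_set T \<and> onorm (resolvent T z) \<le> 1 / \<epsilon>"
  by (auto simp: pseudospectrum_def resolvent_norm_def op_spectrum_def not_less)

section \<open>Perturbation of the operator and of the spectral parameter\<close>

text \<open>With \<open>u = (T' - z0) y\<close>, the pair \<open>(y, (T' - z') y)\<close> is compared with the pair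
  \<open>(S u, (T - z) S u)\<close>, where \<open>S = (T - z0)\<^sup>-\<^sup>1\<close>.\<close>

lemma resolvent_perturbation:
  fixes T T' :: "'a::complex_banach operator"
  assumes T: "linear_operator T" and T': "linear_operator T'"
    and z0: "z0 \<in> resolvent_set T" "z0 \<in> resolvent_set T'"
    and z: "z \<in> resolvent_set T" and C: "onorm (resolvent T z) \<le> C"
    and d: "\<And>x. norm (resolvent T' z0 x - resolvent T z0 x) \<le> d * norm x" and "0 \<le> d"
    and v_def: "v = 1 + cmod (z - z0) * C"
    and e_def: "e = cmod (z' - z0) * d + cmod (z' - z) * onorm (resolvent T z0)"
    and "e * v < 1"
  shows "z' \<in> resolvent_set T'" and "onorm (resolvent T' z') \<le> (C + d * v) / (1 - e * v)"
proof -
  define S where "S = resolvent T z0"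
  define S' where "S' = resolvent T' z0"
  define R where "R = resolvent T z"
  \<comment> \<open>\<open>E u\<close> is the difference
    \<open>op_shift T z (S u) - op_shift T' z' (S' u)\<close>, and \<open>V x\<close> is
    \<open>op_shift T z0 (R x)\<close>, so that \<open>V\<close> inverts the map sending
    \<open>u\<close> to \<open>op_shift T z (S u)\<close>.\<close>
  define E where "E u = (z' - z0) *\<^sub>C S' u - (z - z0) *\<^sub>C S u" for u
  define V where "V x = x + (z - z0) *\<^sub>C R x" for x
  interpret S: bounded_linear S using bounded_linear_resolvent [OF z0(1)] by (simp add: S_def)
  interpret S': bounded_linear S' using bounded_linear_resolvent [OF z0(2)] by (simp add: S'_def)
  interpret R: bounded_linear R using bounded_linear_resolvent [OF z] by (simp add: R_def)
  have nS: "norm (S x) \<le> onorm (resolvent T z0) * norm x" for x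
    unfolding S_def by (rule norm_resolvent_le [OF z0(1)])
  have nR: "norm (R x) \<le> C * norm x" for x
    unfolding R_def using norm_resolvent_le [OF z, of x] C
    by (meson mult_right_mono norm_ge_zero order_trans)
  have "0 \<le> C"
    using C onorm_pos_le [OF bounded_linear_resolvent [OF z]] by linarith
  then have v1: "1 \<le> v" unfolding v_def by simp
  have "0 \<le> e"
    using \<open>0 \<le> d\<close> onorm_pos_le [OF bounded_linear_resolvent [OF z0(1)]] by (simp add: e_def)
  have nE: "norm (E u) \<le> e * norm u" for u
  proof -
    \<comment> \<open>The first term is the change of the operator, the second that of the spectral
      parameter; they give the two summands of \<open>e\<close>.\<close>
    have "E u = (z' - z0) *\<^sub>C (S' u - S u) + (z' - z) *\<^sub>C S u"
      by (simp add: E_def scaleC_diff_right scaleC_diff_left)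
    then have "norm (E u) \<le> cmod (z' - z0) * norm (S' u - S u) + cmod (z' - z) * norm (S u)"
      by (metis norm_scaleC norm_triangle_ineq)
    also have "\<dots> \<le> cmod (z' - z0) * (d * norm u) + cmod (z' - z) * (onorm (resolvent T z0) * norm u)"
      using d [of u] nS [of u] by (intro add_mono mult_left_mono) (auto simp: S_def S'_def)
    finally show ?thesis by (simp add: e_def algebra_simps)
  qed
  have nV: "norm (V x) \<le> v * norm x" for x
  proof -
    have "norm (V x) \<le> norm x + cmod (z - z0) * norm (R x)"
      unfolding V_def by (metis norm_scaleC norm_triangle_ineq)
    also have "\<dots> \<le> norm x + cmod (z - z0) * (C * norm x)"
      using nR by (intro add_left_mono mult_left_mono) auto
    finally show ?thesis by (simp add: v_def algebra_simps)
  qed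
  have diffE: "E u - E w = E (u - w)" for u w
    by (simp add: E_def S.diff S'.diff scaleC_diff_right)
  have diffV: "V u - V w = V (u - w)" for u w
    by (simp add: V_def R.diff scaleC_diff_right)
  have nEV: "norm (E (V x)) \<le> (e * v) * norm x" for x
    using nE [of "V x"] mult_left_mono [OF nV [of x] \<open>0 \<le> e\<close>] by (simp add: mult.assoc)
  have shiftS: "S u \<in> op_dom T" "op_shift T z (S u) = u - (z - z0) *\<^sub>C S u" for u
    using resolvent_in_dom [OF z0(1)] op_shift_resolvent [OF z0(1)]
      op_shift_shift [of T z "S u" z0] scaleC_minus_left [of "z - z0" "S u"]
    by (auto simp: S_def)
  have shiftS': "S' u \<in> op_dom T'" "op_shift T' z' (S' u) = u - (z' - z0) *\<^sub>C S' u" for u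
    using resolvent_in_dom [OF z0(2)] op_shift_resolvent [OF z0(2)]
      op_shift_shift [of T' z' "S' u" z0] scaleC_minus_left [of "z' - z0" "S' u"]
    by (auto simp: S'_def)
  have RS: "R (u - (z - z0) *\<^sub>C S u) = S u" for u
    using resolvent_op_shift [OF z shiftS(1)] shiftS(2) by (simp add: R_def)
  have VS: "V u - (z - z0) *\<^sub>C S (V u) = u" for u
  proof -
    have "op_shift T z0 (R u) = u + (z - z0) *\<^sub>C R u"
      using op_shift_shift [of T z0 "R u" z] op_shift_resolvent [OF z] by (simp add: R_def)
    then have "S (V u) = R u"
      using resolvent_op_shift [OF z0(1) resolvent_in_dom [OF z], of u] by (simp add: V_def S_def R_def)
    then show ?thesis by (simp add: V_def)
  qed
  have surj: "\<exists>y\<in>op_dom T'. op_shift T' z' y = x" for x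
  proof -
    \<comment> \<open>For \<open>y = S' (V x0)\<close> the equation
      \<open>op_shift T' z' y = x\<close> becomes this fixed point equation, whose right-hand map is
      a contraction since \<open>e * v < 1\<close>.\<close>
    have "\<exists>!x0. x + E (V x0) = x0"
    proof (rule banach_fix_type [of "e * v"])
      show "\<forall>a b. dist (x + E (V a)) (x + E (V b)) \<le> e * v * dist a b"
        using nEV by (simp add: dist_norm diffE diffV)
    qed (use \<open>0 \<le> e\<close> v1 \<open>e * v < 1\<close> in auto)
    then obtain x0 where x0: "x + E (V x0) = x0" by blast
    have "op_shift T' z' (S' (V x0)) = V x0 - (z - z0) *\<^sub>C S (V x0) - E (V x0)"
      by (simp add: shiftS' E_def)
    also have "\<dots> = x"
      using x0 unfolding VS by (simp add: algebra_simps)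
    finally show ?thesis using shiftS'(1) by blast
  qed
  have bound: "norm y \<le> (C + d * v) / (1 - e * v) * norm (op_shift T' z' y)"
    if y: "y \<in> op_dom T'" for y
  proof -
    define u where "u = op_shift T' z0 y"
    define x0 where "x0 = u - (z - z0) *\<^sub>C S u"
    have yS: "y = S' u"
      using resolvent_op_shift [OF z0(2) y] by (simp add: u_def S'_def)
    have x: "op_shift T' z' y = x0 - E u"
      unfolding yS shiftS'(2) by (simp add: x0_def E_def)
    have Sx0: "S u = R x0" unfolding x0_def RS ..
    then have "u = V x0" by (simp add: V_def x0_def)
    then have nu: "norm u \<le> v * norm x0" using nV by simp
    \<comment> \<open>Here \<open>x0 - E u\<close> is \<open>op_shift T' z' y\<close>, and the
      contribution of \<open>E u\<close> is absorbed into the left-hand side because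
      \<open>e * v < 1\<close>.\<close>
    have "norm x0 \<le> norm (x0 - E u) + norm (E u)"
      by (metis diff_add_cancel norm_triangle_ineq)
    also have "norm (E u) \<le> e * v * norm x0"
      using nEV \<open>u = V x0\<close> by simp
    finally have "(1 - e * v) * norm x0 \<le> norm (op_shift T' z' y)"
      by (simp add: x algebra_simps)
    then have nx0: "norm x0 \<le> norm (op_shift T' z' y) / (1 - e * v)"
      using \<open>e * v < 1\<close> by (simp add: field_simps)
    have "norm y \<le> norm (R x0) + norm (S' u - S u)"
      unfolding yS Sx0 [symmetric] by (metis add.commute diff_add_cancel norm_triangle_ineq)
    also have "\<dots> \<le> C * norm x0 + d * norm u"
      using nR [of x0] d [of u] by (simp add: S_def S'_def)
    also have "\<dots> \<le> C * norm x0 + d * (v * norm x0)"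
      using nu \<open>0 \<le> d\<close> by (intro add_left_mono mult_left_mono)
    also have "\<dots> = (C + d * v) * norm x0"
      by (simp add: algebra_simps)
    also have "\<dots> \<le> (C + d * v) * (norm (op_shift T' z' y) / (1 - e * v))"
      using nx0 \<open>0 \<le> C\<close> \<open>0 \<le> d\<close> v1 by (intro mult_left_mono) auto
    finally show ?thesis by simp
  qed
  have "0 \<le> (C + d * v) / (1 - e * v)"
    using \<open>0 \<le> C\<close> \<open>0 \<le> d\<close> v1 \<open>e * v < 1\<close> by simp
  then show "z' \<in> resolvent_set T'" "onorm (resolvent T' z') \<le> (C + d * v) / (1 - e * v)"
    using resolvent_set_intro [OF T' _ bound surj] by auto
qed

section \<open>The maximum principle for the resolvent norm\<close>

text \<open>For \<open>0 < n < m\<close> the sum is geometric, with ratio an \<open>m\<close>-th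
  root of unity other than 1. In the averaging below it removes every Neumann term except that of
  order zero.\<close>

lemma sum_roots_unity_powers:
  fixes m n :: nat
  assumes "n < m"
  shows "(\<Sum>j<m. exp (2 * of_real pi * \<i> * of_nat j / of_nat m) ^ n) = (if n = 0 then of_nat m else 0 :: complex)"
proof (cases "n = 0")
  case False
  define w :: complex where "w = exp (2 * of_real pi * \<i> * of_nat n / of_nat m)"
  have "w \<noteq> 1"
    using complex_root_unity_eq_1 [of m n] assms False
    by (auto simp: w_def dest: dvd_imp_le)
  have "w ^ m = 1"
    using complex_root_unity [of m n] assms by (simp add: w_def)
  have "exp (2 * of_real pi * \<i> * of_nat j / of_nat m) ^ n = w ^ j" for j :: nat
    by (simp add: w_def exp_of_nat_mult [symmetric] mult_ac)
  then have "(\<Sum>j<m. exp (2 * of_real pi * \<i> * of_nat j / of_nat m) ^ n) = (\<Sum>j<m. w ^ j)"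
    by simp
  also have "\<dots> = 0"
    using geometric_sum [OF \<open>w \<noteq> 1\<close>, of m] \<open>w ^ m = 1\<close> by simp
  finally show ?thesis using False by simp
qed simp

text \<open>Averaging the truncated Neumann series of \<open>(T - z - h \<omega>)\<^sup>-\<^sup>1\<close> over the \<open>m\<close>-th roots of unity
  \<open>\<omega>\<close> leaves \<open>(T - z)\<^sup>-\<^sup>1\<close> up to an error of order \<open>q\<^sup>m\<close> with \<open>q < 1\<close>. This is small even compared
  with the weight \<open>1/m\<close> of the single point \<open>z + h\<close>, so the norm there cannot be smaller than
  at \<open>z\<close>.\<close>

lemma resolvent_norm_local_max:
  fixes T :: "'a::complex_banach operator"
  assumes T: "linear_operator T"
    and ball: "\<And>w. cmod (w - z) \<le> cmod h \<Longrightarrow>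
      w \<in> resolvent_set T \<and> onorm (resolvent T w) \<le> onorm (resolvent T z)"
    and h: "cmod h * onorm (resolvent T z) < 1"
  shows "onorm (resolvent T (z + h)) = onorm (resolvent T z)"
proof -
  define A where "A = resolvent T z"
  define a where "a = onorm A"
  define b where "b = onorm (resolvent T (z + h))"
  define q where "q = cmod h * a"
  have z: "z \<in> resolvent_set T" using ball [of z] by simp
  interpret A: bounded_linear A using bounded_linear_resolvent [OF z] by (simp add: A_def)
  have A_scaleC: "A (c *\<^sub>C x) = c *\<^sub>C A x" for c x
    unfolding A_def by (rule resolvent_scaleC [OF T z])
  have nA: "norm (A x) \<le> a * norm x" for x
    unfolding a_def A_def by (rule norm_resolvent_le [OF z])
  have "0 \<le> a" unfolding a_def by (rule onorm_pos_le [OF A.bounded_linear_axioms])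
  have nApow: "norm ((A ^^ n) x) \<le> a ^ n * norm x" for n x
  proof (induction n)
    case (Suc n)
    have "norm ((A ^^ Suc n) x) \<le> a * norm ((A ^^ n) x)" using nA by simp
    also have "\<dots> \<le> a * (a ^ n * norm x)" by (rule mult_left_mono [OF Suc \<open>0 \<le> a\<close>])
    finally show ?case by (simp add: mult.assoc)
  qed simp
  have zh: "z + h \<in> resolvent_set T" "b \<le> a"
    using ball [of "z + h"] by (auto simp: a_def b_def A_def)
  have "0 \<le> b" unfolding b_def by (rule onorm_pos_le [OF bounded_linear_resolvent [OF zh(1)]])
  \<comment> \<open>The number \<open>b\<close> enters through the single root
    \<open>\<omega> 0 = 1\<close>; the other \<open>m - 1\<close> points are estimated by
    \<open>a\<close>, and the factor \<open>1 + q ^ m\<close> comes from the Neumann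
    remainder.\<close>
  have main: "real m * a \<le> (b + (real m - 1) * a) * (1 + q ^ m)" if "0 < m" for m
  proof -
    have "norm (A x) \<le> (b + (real m - 1) * a) * (1 + q ^ m) / m * norm x" for x
    proof -
      define \<omega> :: "nat \<Rightarrow> complex" where "\<omega> j = exp (2 * of_real pi * \<i> * of_nat j / of_nat m)" for j
      have n\<omega>: "cmod (\<omega> j) = 1" for j
        by (simp add: \<omega>_def)
      have \<omega>m: "\<omega> j ^ m = 1" for j
        using complex_root_unity [of m j] \<open>0 < m\<close> by (simp add: \<omega>_def)
      define y where "y j = resolvent T (z + h * \<omega> j) x" for j
      have \<rho>: "z + h * \<omega> j \<in> resolvent_set T" "onorm (resolvent T (z + h * \<omega> j)) \<le> a" for j
        using ball [of "z + h * \<omega> j"] by (auto simp: norm_mult n\<omega> a_def A_def)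
      \<comment> \<open>This is the first resolvent identity for the points \<open>z\<close> and
        \<open>z + h * \<omega> j\<close>.\<close>
      have y1: "y j = A x + (h * \<omega> j) *\<^sub>C A (y j)" for j
      proof -
        have "op_shift T z (y j) = x + (h * \<omega> j) *\<^sub>C y j"
          using op_shift_shift [of T z "y j" "z + h * \<omega> j"] op_shift_resolvent [OF \<rho>(1)]
          by (simp add: y_def)
        then have "y j = A (x + (h * \<omega> j) *\<^sub>C y j)"
          using resolvent_op_shift [OF z resolvent_in_dom [OF \<rho>(1)], of j x]
          by (simp add: y_def A_def)
        then show ?thesis by (simp add: A.add A_scaleC)
      qed
      have y_pow: "(A ^^ n) (y j) = (A ^^ Suc n) x + (h * \<omega> j) *\<^sub>C (A ^^ Suc n) (y j)" for j n
      proof (induction n)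
        case 0
        from y1 [of j] show ?case unfolding funpow.simps id_apply o_apply .
      next
        case (Suc n)
        have "(A ^^ Suc n) (y j) = A ((A ^^ Suc n) x + (h * \<omega> j) *\<^sub>C (A ^^ Suc n) (y j))"
          using arg_cong [OF Suc, of A] unfolding funpow.simps o_apply .
        also have "\<dots> = (A ^^ Suc (Suc n)) x + (h * \<omega> j) *\<^sub>C (A ^^ Suc (Suc n)) (y j)"
          by (simp add: A.add A_scaleC)
        finally show ?case .
      qed
      \<comment> \<open>Iterating the identity gives a finite Neumann expansion with exact
        remainder, so no infinite series has to be summed.\<close>
      have yn: "y j = (\<Sum>i<n. ((h * \<omega> j) ^ i) *\<^sub>C (A ^^ Suc i) x) + ((h * \<omega> j) ^ n) *\<^sub>C (A ^^ n) (y j)"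
        for j n
      proof (induction n)
        case (Suc n)
        have "((h * \<omega> j) ^ n) *\<^sub>C (A ^^ n) (y j) =
            ((h * \<omega> j) ^ n) *\<^sub>C (A ^^ Suc n) x + ((h * \<omega> j) ^ Suc n) *\<^sub>C (A ^^ Suc n) (y j)"
          by (subst y_pow) (simp only: scaleC_add_right scaleC_scaleC power_Suc2)
        then show ?case
          using Suc by (metis (no_types, lifting) add.assoc sum.lessThan_Suc)
      qed simp
      define Y where "Y = (\<Sum>j<m. y j)"
      have addApow: "(A ^^ n) (\<Sum>j<k. y j) = (\<Sum>j<k. (A ^^ n) (y j))" for n k
        by (induction n) (simp_all add: A.sum)
      have "Y = (\<Sum>j<m. (\<Sum>i<m. ((h * \<omega> j) ^ i) *\<^sub>C (A ^^ Suc i) x) + ((h * \<omega> j) ^ m) *\<^sub>C (A ^^ m) (y j))"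
        unfolding Y_def using yn by (rule sum.cong [OF refl])
      \<comment> \<open>Since \<open>\<omega> j ^ m = 1\<close>, the remainders carry the common
        factor \<open>h ^ m\<close>, so their sum depends only on \<open>Y\<close>.\<close>
      also have "\<dots> = (\<Sum>i<m. (\<Sum>j<m. (h * \<omega> j) ^ i) *\<^sub>C (A ^^ Suc i) x) + (\<Sum>j<m. h ^ m *\<^sub>C (A ^^ m) (y j))"
        unfolding sum.distrib scaleC_sum_left
        by (subst sum.swap) (simp add: power_mult_distrib \<omega>m)
      also have "(\<Sum>j<m. h ^ m *\<^sub>C (A ^^ m) (y j)) = h ^ m *\<^sub>C (A ^^ m) Y"
        by (simp add: Y_def addApow scaleC_sum_right)
      also have "(\<Sum>i<m. (\<Sum>j<m. (h * \<omega> j) ^ i) *\<^sub>C (A ^^ Suc i) x)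
          = (\<Sum>i<m. (if i = 0 then of_nat m *\<^sub>C A x else 0))"
      proof (rule sum.cong [OF refl])
        fix i assume "i \<in> {..<m}"
        then have "(\<Sum>j<m. (h * \<omega> j) ^ i) = (if i = 0 then of_nat m else 0)"
          using sum_roots_unity_powers [of i m]
          by (simp add: power_mult_distrib \<omega>_def flip: sum_distrib_left)
        then show "(\<Sum>j<m. (h * \<omega> j) ^ i) *\<^sub>C (A ^^ Suc i) x = (if i = 0 then of_nat m *\<^sub>C A x else 0)"
          by simp
      qed
      also have "\<dots> = of_nat m *\<^sub>C A x"
        using \<open>0 < m\<close> by (simp add: sum.delta)
      finally have "of_nat m *\<^sub>C A x = Y - h ^ m *\<^sub>C (A ^^ m) Y"
        by (simp add: algebra_simps)
      then have "real m * norm (A x) \<le> norm Y + norm (h ^ m *\<^sub>C (A ^^ m) Y)"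
        by (metis norm_of_nat norm_scaleC norm_triangle_ineq4)
      also have "\<dots> \<le> norm Y + cmod h ^ m * (a ^ m * norm Y)"
        by (simp add: norm_scaleC norm_power mult_left_mono nApow)
      also have "\<dots> = norm Y * (1 + q ^ m)"
        by (simp add: q_def power_mult_distrib algebra_simps)
      also have "\<dots> \<le> ((b + (real m - 1) * a) * norm x) * (1 + q ^ m)"
      proof (rule mult_right_mono)
        have ya: "norm (y j) \<le> a * norm x" for j
          unfolding y_def using norm_resolvent_le [OF \<rho>(1)] \<rho>(2)
          by (meson mult_right_mono norm_ge_zero order_trans)
        have "norm (y 0) \<le> b * norm x"
          using norm_resolvent_le [OF zh(1)] by (simp add: y_def b_def \<omega>_def)
        moreover have "norm (\<Sum>j\<in>{1..<m}. y j) \<le> (real m - 1) * (a * norm x)"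
          using sum_norm_bound [of "{1..<m}" y "a * norm x"] ya \<open>0 < m\<close> by (simp add: of_nat_diff)
        moreover have "Y = y 0 + (\<Sum>j\<in>{1..<m}. y j)"
          unfolding Y_def using \<open>0 < m\<close> by (simp add: lessThan_atLeast0 sum.atLeast_Suc_lessThan)
        ultimately show "norm Y \<le> (b + (real m - 1) * a) * norm x"
          using norm_triangle_ineq [of "y 0" "\<Sum>j\<in>{1..<m}. y j"] by (simp add: algebra_simps)
        show "0 \<le> 1 + q ^ m" using \<open>0 \<le> a\<close> by (simp add: q_def)
      qed
      finally show ?thesis using \<open>0 < m\<close> by (simp add: field_simps)
    qed
    moreover have "0 \<le> (b + (real m - 1) * a) * (1 + q ^ m) / m"
      using \<open>0 \<le> a\<close> \<open>0 \<le> b\<close> \<open>0 < m\<close> by (simp add: q_def)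
    ultimately have "onorm A \<le> (b + (real m - 1) * a) * (1 + q ^ m) / m"
      by (intro onorm_bound)
    then show ?thesis using \<open>0 < m\<close> by (simp add: field_simps flip: a_def)
  qed
  \<comment> \<open>Subtracting \<open>(real m - 1) * a\<close> in \<open>main\<close> isolates
    \<open>b\<close>. The error is then \<open>m\<close> times a geometric term, which still
    vanishes because \<open>q < 1\<close>.\<close>
  have "a \<le> b + a * (real m * q ^ m)" if "0 < m" for m
  proof -
    have "b + (real m - 1) * a \<le> real m * a"
      using \<open>b \<le> a\<close> by (simp add: algebra_simps)
    then have "(b + (real m - 1) * a) * q ^ m \<le> real m * a * q ^ m"
      using \<open>0 \<le> a\<close> by (intro mult_right_mono) (auto simp: q_def)
    then show ?thesis using main [OF that] by (simp add: algebra_simps)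
  qed
  moreover have "(\<lambda>m. b + a * (real m * q ^ m)) \<longlonglongrightarrow> b + a * 0"
  proof (intro tendsto_intros)
    have "norm q < 1" using h \<open>0 \<le> a\<close> by (simp add: q_def a_def A_def abs_mult)
    then show "(\<lambda>m. real m * q ^ m) \<longlonglongrightarrow> 0" by (rule powser_times_n_limit_0)
  qed
  ultimately have "a \<le> b"
    by (intro LIMSEQ_le_const [of "\<lambda>m. b + a * (real m * q ^ m)"]) (auto intro!: exI [of _ 1])
  then show ?thesis using zh(2) by (simp add: a_def b_def A_def)
qed

text \<open>Outside the pseudospectrum only a non-strict bound is available. The strict one, which
  leaves room for perturbation, is where the non-constancy of the resolvent norm enters.\<close>

lemma not_in_closure_pseudospectrum:
  fixes T :: "'a::complex_banach operator"
  assumes T: "linear_operator T" and "0 < \<epsilon>"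
    and nonconst: "\<And>U. open U \<Longrightarrow> U \<noteq> {} \<Longrightarrow> U \<subseteq> resolvent_set T \<Longrightarrow>
           \<not> (\<lambda>z. onorm (resolvent T z)) constant_on U"
    and z: "z \<notin> closure (pseudospectrum \<epsilon> T)"
  shows "z \<in> resolvent_set T" and "onorm (resolvent T z) < 1 / \<epsilon>"
proof -
  have "open (- closure (pseudospectrum \<epsilon> T))" "z \<in> - closure (pseudospectrum \<epsilon> T)"
    using z by auto
  then obtain r where "0 < r" and r: "ball z r \<subseteq> - closure (pseudospectrum \<epsilon> T)"
    by (meson open_contains_ball)
  have ball: "w \<in> resolvent_set T \<and> onorm (resolvent T w) \<le> 1 / \<epsilon>" if "w \<in> ball z r" for w
    using r that closure_subset not_in_pseudospectrum_iff by fast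
  show "z \<in> resolvent_set T" using ball \<open>0 < r\<close> by auto
  show "onorm (resolvent T z) < 1 / \<epsilon>"
  proof (rule ccontr)
    assume "\<not> onorm (resolvent T z) < 1 / \<epsilon>"
    then have max: "onorm (resolvent T z) = 1 / \<epsilon>"
      using ball [of z] \<open>0 < r\<close> by auto
    \<comment> \<open>Radius \<open>r\<close> keeps the disc off the pseudospectrum; radius
      \<open>\<epsilon>\<close> makes \<open>cmod (w - z) * (1 / \<epsilon>) < 1\<close>, as the
      maximum principle demands.\<close>
    have "onorm (resolvent T w) = 1 / \<epsilon>" if w: "w \<in> ball z (min r \<epsilon>)" for w
    proof -
      have "onorm (resolvent T (z + (w - z))) = onorm (resolvent T z)"
      proof (rule resolvent_norm_local_max [OF T])
        fix v assume "cmod (v - z) \<le> cmod (w - z)"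
        then have "v \<in> ball z r" using w by (auto simp: dist_norm norm_minus_commute)
        then show "v \<in> resolvent_set T \<and> onorm (resolvent T v) \<le> onorm (resolvent T z)"
          using ball max by simp
      next
        show "cmod (w - z) * onorm (resolvent T z) < 1"
          using w \<open>0 < \<epsilon>\<close> by (simp add: max dist_norm norm_minus_commute)
      qed
      then show ?thesis using max by simp
    qed
    then have "(\<lambda>z. onorm (resolvent T z)) constant_on ball z (min r \<epsilon>)"
      unfolding constant_on_def by blast
    moreover have "ball z (min r \<epsilon>) \<subseteq> resolvent_set T" using ball by auto
    ultimately show False
      using nonconst [of "ball z (min r \<epsilon>)"] \<open>0 < r\<close> \<open>0 < \<epsilon>\<close> by simp
  qed
qed

section \<open>Norm resolvent convergence\<close>

text \<open>The perturbation bound tends to \<open>onorm (resolvent T z)\<close> jointly in the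
  index and the spectral parameter, hence ends up below \<open>1 / \<epsilon>\<close> on a whole
  neighbourhood.\<close>

lemma eventually_disjoint_pseudospectrum:
  fixes T :: "'a::complex_banach operator"
  assumes T: "linear_operator T" and Tk: "\<And>k::nat. linear_operator (Tk k)"
    and z0: "z0 \<in> resolvent_set T" "\<And>k. z0 \<in> resolvent_set (Tk k)"
    and lim: "(\<lambda>k. onorm (\<lambda>x. resolvent (Tk k) z0 x - resolvent T z0 x)) \<longlonglongrightarrow> 0"
    and z: "z \<in> resolvent_set T" "onorm (resolvent T z) < 1 / \<epsilon>"
  shows "\<exists>r>0. \<forall>\<^sub>F k in sequentially. ball z r \<inter> closure (pseudospectrum \<epsilon> (Tk k)) = {}"
proof -
  define d where "d k = onorm (\<lambda>x. resolvent (Tk k) z0 x - resolvent T z0 x)" for k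
  have bl: "bounded_linear (\<lambda>x. resolvent (Tk k) z0 x - resolvent T z0 x)" for k
    using z0 by (intro bounded_linear_sub bounded_linear_resolvent)
  have d: "norm (resolvent (Tk k) z0 x - resolvent T z0 x) \<le> d k * norm x" "0 \<le> d k" for k x
    unfolding d_def by (rule onorm [OF bl], rule onorm_pos_le [OF bl])
  define C where "C = onorm (resolvent T z)"
  define v where "v = 1 + cmod (z - z0) * C"
  define e where "e p = cmod (snd p - z0) * d (fst p) + cmod (snd p - z) * onorm (resolvent T z0)"
    for p :: "nat \<times> complex"
  \<comment> \<open>Convergence along the product filter yields one radius valid for all large
    \<open>k\<close>, and one threshold for \<open>k\<close> valid on the whole ball.\<close>
  let ?F = "sequentially \<times>\<^sub>F nhds z"
  have lim_d: "((\<lambda>p. d (fst p)) \<longlongrightarrow> 0) ?F"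
    using filterlim_compose [OF lim filterlim_fst] by (simp add: d_def)
  have lim_snd: "(snd \<longlongrightarrow> z) ?F"
    by (rule filterlim_snd)
  have "(e \<longlongrightarrow> cmod (z - z0) * 0 + cmod (z - z) * onorm (resolvent T z0)) ?F"
    unfolding e_def by (intro tendsto_intros lim_d lim_snd)
  then have "((\<lambda>p. e p * v) \<longlongrightarrow> 0 * v) ?F"
    by (intro tendsto_mult_right) simp
  then have lim_ev: "((\<lambda>p. e p * v) \<longlongrightarrow> 0) ?F" by simp
  then have "((\<lambda>p. (C + d (fst p) * v) / (1 - e p * v)) \<longlongrightarrow> (C + 0 * v) / (1 - 0)) ?F"
    by (intro tendsto_intros lim_d) auto
  then have "\<forall>\<^sub>F p in ?F. (C + d (fst p) * v) / (1 - e p * v) < 1 / \<epsilon>"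
    using z(2) by (intro order_tendstoD) (auto simp: C_def)
  moreover have "\<forall>\<^sub>F p in ?F. e p * v < 1"
    using lim_ev by (rule order_tendstoD) simp
  ultimately have "\<forall>\<^sub>F p in ?F. snd p \<notin> pseudospectrum \<epsilon> (Tk (fst p))"
  proof eventually_elim
    case (elim p)
    note perturb = resolvent_perturbation
      [OF T Tk z0(1) z0(2) z(1) order_refl d v_def [unfolded C_def] e_def elim(2)]
    show ?case
      using perturb elim(1) unfolding not_in_pseudospectrum_iff C_def by simp
  qed
  then obtain P Q where P: "\<forall>\<^sub>F k in sequentially. P k" and Q: "\<forall>\<^sub>F w in nhds z. Q w"
    and PQ: "\<And>k w. P k \<Longrightarrow> Q w \<Longrightarrow> w \<notin> pseudospectrum \<epsilon> (Tk k)"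
    unfolding eventually_prod_filter by auto
  obtain r where "0 < r" and r: "\<And>w. w \<in> ball z r \<Longrightarrow> Q w"
    using Q unfolding eventually_nhds_metric by (auto simp: dist_commute)
  have "\<forall>\<^sub>F k in sequentially. ball z r \<inter> closure (pseudospectrum \<epsilon> (Tk k)) = {}"
    using P
  proof eventually_elim
    case (elim k)
    then show ?case
      \<comment> \<open>An open set that misses a set also misses its closure.\<close>
      using PQ r by (subst open_Int_closure_eq_empty) auto
  qed
  then show ?thesis using \<open>0 < r\<close> by blast
qed

text \<open>The perturbation estimate is applied with \<open>T\<close> and \<open>Tk k\<close>
  exchanged: if \<open>z\<close> avoided infinitely many of the pseudospectra, the bound
  \<open>1 / \<epsilon>\<close> would pass to the limit \<open>T\<close>.\<close>

lemma eventually_in_pseudospectrum: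
  fixes T :: "'a::complex_banach operator"
  assumes T: "linear_operator T" and Tk: "\<And>k::nat. linear_operator (Tk k)"
    and z0: "z0 \<in> resolvent_set T" "\<And>k. z0 \<in> resolvent_set (Tk k)"
    and lim: "(\<lambda>k. onorm (\<lambda>x. resolvent (Tk k) z0 x - resolvent T z0 x)) \<longlonglongrightarrow> 0"
    and z: "z \<in> pseudospectrum \<epsilon> T"
  shows "\<forall>\<^sub>F k in sequentially. z \<in> pseudospectrum \<epsilon> (Tk k)"
proof (rule ccontr)
  assume "\<not> ?thesis"
  then have freq: "\<exists>\<^sub>F k in sequentially. z \<notin> pseudospectrum \<epsilon> (Tk k)"
    by (simp add: frequently_def)
  define d where "d k = onorm (\<lambda>x. resolvent (Tk k) z0 x - resolvent T z0 x)" for k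
  have bl: "bounded_linear (\<lambda>x. resolvent (Tk k) z0 x - resolvent T z0 x)" for k
    using z0 by (intro bounded_linear_sub bounded_linear_resolvent)
  have d: "norm (resolvent T z0 x - resolvent (Tk k) z0 x) \<le> d k * norm x" "0 \<le> d k" for k x
    unfolding d_def using onorm [OF bl, of k x] onorm_pos_le [OF bl]
    by (simp_all add: norm_minus_commute)
  define C where "C = 1 / \<epsilon>"
  define v where "v = 1 + cmod (z - z0) * C"
  \<comment> \<open>With the spectral parameter fixed the second summand is zero, so the varying
    norms \<open>onorm (resolvent (Tk k) z0)\<close> do not affect the limit.\<close>
  define e where "e k = cmod (z - z0) * d k + cmod (z - z) * onorm (resolvent (Tk k) z0)" for k
  define M where "M k = (C + d k * v) / (1 - e k * v)" for k
  have lim_d: "d \<longlonglongrightarrow> 0" using lim by (simp add: d_def [abs_def])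
  have "(\<lambda>k. cmod (z - z0) * d k * v) \<longlonglongrightarrow> cmod (z - z0) * 0 * v"
    by (intro tendsto_intros lim_d)
  then have lim_ev: "(\<lambda>k. e k * v) \<longlonglongrightarrow> 0" by (simp add: e_def)
  have "M \<longlonglongrightarrow> (C + 0 * v) / (1 - 0)"
    unfolding M_def by (intro tendsto_intros lim_d lim_ev) auto
  then have "M \<longlonglongrightarrow> C" by simp
  have step: "z \<in> resolvent_set T \<and> onorm (resolvent T z) \<le> M k"
    if k: "z \<notin> pseudospectrum \<epsilon> (Tk k)" and ev: "e k * v < 1" for k
  proof -
    have "z \<in> resolvent_set (Tk k)" "onorm (resolvent (Tk k) z) \<le> C"
      using k by (auto simp: not_in_pseudospectrum_iff C_def)
    from resolvent_perturbation [OF Tk T z0(2) z0(1) this d v_def e_def ev]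
    show ?thesis by (simp add: M_def)
  qed
  have ev1: "\<forall>\<^sub>F k in sequentially. e k * v < 1"
    using lim_ev by (rule order_tendstoD) simp
  \<comment> \<open>One such index places \<open>z\<close> in the resolvent set of \<open>T\<close>,
    where membership in the pseudospectrum means \<open>C < onorm (resolvent T z)\<close>. A later
    index then contradicts this.\<close>
  obtain k where "z \<notin> pseudospectrum \<epsilon> (Tk k)" "e k * v < 1"
    using frequently_ex [OF frequently_eventually_frequently [OF freq ev1]] by blast
  then have "z \<in> resolvent_set T" using step by blast
  then have gt: "C < onorm (resolvent T z)"
    using z not_in_pseudospectrum_iff by (force simp: C_def)
  have "\<forall>\<^sub>F k in sequentially. M k < onorm (resolvent T z)"
    using \<open>M \<longlonglongrightarrow> C\<close> gt by (rule order_tendstoD)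
  with ev1 have "\<forall>\<^sub>F k in sequentially. e k * v < 1 \<and> M k < onorm (resolvent T z)"
    by (rule eventually_conj)
  then obtain k where "z \<notin> pseudospectrum \<epsilon> (Tk k)" "e k * v < 1" "M k < onorm (resolvent T z)"
    using frequently_ex [OF frequently_eventually_frequently [OF freq]] by blast
  then show False using step [of k] by simp
qed

section \<open>Hausdorff distance\<close>

text \<open>Non-emptiness and the common bound \<open>\<delta>\<close> keep both suprema away from
  their default values; otherwise even non-negativity could not be inferred.\<close>

lemma hausdorff_dist_bounds:
  assumes "A \<noteq> {}" "B \<noteq> {}"
    and "\<And>z. z \<in> A \<Longrightarrow> infdist z B \<le> \<delta>" "\<And>z. z \<in> B \<Longrightarrow> infdist z A \<le> \<delta>"
  shows "0 \<le> hausdorff_dist A B" and "hausdorff_dist A B \<le> \<delta>"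
proof -
  obtain a where a: "a \<in> A" using assms(1) by auto
  have "bdd_above ((\<lambda>z. infdist z B) ` A)" using assms(3) by (rule bdd_aboveI2)
  then have "0 \<le> (SUP z\<in>A. infdist z B)"
    using a by (meson cSUP_upper2 infdist_nonneg)
  then show "0 \<le> hausdorff_dist A B" by (simp add: hausdorff_dist_def)
  show "hausdorff_dist A B \<le> \<delta>"
    unfolding hausdorff_dist_def using assms by (auto intro!: cSUP_least)
qed

section \<open>Both one-sided distances, by finite covers of compact sets\<close>

theorem mainTheorem2:
  fixes T :: "'a::complex_banach operator"
    and Tk :: "nat \<Rightarrow> 'a operator"
    and K :: "complex set"
    and \<epsilon> :: real
  assumes "closed_operator T" and "densely_defined T"
    and "\<And>k. closed_operator (Tk k)" and "\<And>k. densely_defined (Tk k)"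
    and "compact K" and "\<epsilon> > 0"
    and "closure (pseudospectrum \<epsilon> T) \<inter> K = closure (pseudospectrum \<epsilon> T \<inter> K)"
    and "closure (pseudospectrum \<epsilon> T) \<inter> K \<noteq> {}"
    and "\<And>U. open U \<Longrightarrow> U \<noteq> {} \<Longrightarrow> U \<subseteq> resolvent_set T \<Longrightarrow>
           \<not> (\<lambda>z. onorm (resolvent T z)) constant_on U"
    and "\<exists>z0. z0 \<in> (\<Inter>k. resolvent_set (Tk k)) \<inter> resolvent_set T \<and>
           (\<lambda>k. onorm (\<lambda>x. resolvent (Tk k) z0 x - resolvent T z0 x)) \<longlonglongrightarrow> 0"
  shows "(\<forall>\<^sub>F k in sequentially. closure (pseudospectrum \<epsilon> (Tk k)) \<inter> K \<noteq> {}) \<and>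
         (\<lambda>k. hausdorff_dist (closure (pseudospectrum \<epsilon> (Tk k)) \<inter> K)
                             (closure (pseudospectrum \<epsilon> T) \<inter> K)) \<longlonglongrightarrow> 0"
proof -
  define A where "A = closure (pseudospectrum \<epsilon> T) \<inter> K"
  define B where "B k = closure (pseudospectrum \<epsilon> (Tk k)) \<inter> K" for k
  have lin: "linear_operator T" "linear_operator (Tk k)" for k
    using assms(1,3) by (auto simp: closed_operator_def)
  obtain z0 where z0: "z0 \<in> resolvent_set T" "\<And>k. z0 \<in> resolvent_set (Tk k)"
    and lim: "(\<lambda>k. onorm (\<lambda>x. resolvent (Tk k) z0 x - resolvent T z0 x)) \<longlonglongrightarrow> 0"
    using assms(10) by auto
  have A: "A = closure (pseudospectrum \<epsilon> T \<inter> K)" "A \<noteq> {}"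
    using assms(7,8) by (auto simp: A_def)
  have "compact A"
    unfolding A_def using \<open>compact K\<close> by (simp add: closed_Int_compact)
  have upper: "\<forall>\<^sub>F k in sequentially. \<forall>z\<in>B k. infdist z A \<le> \<delta>" if "0 < \<delta>" for \<delta>
  proof -
    \<comment> \<open>\<open>L\<close> is the part of \<open>K\<close> that \<open>B k\<close> must
      leave. Compactness reduces this to finitely many balls, each eventually free of the
      pseudospectra of \<open>Tk k\<close>.\<close>
    define L where "L = K \<inter> {z. \<delta> \<le> infdist z A}"
    have "closed {z. \<delta> \<le> infdist z A}"
      by (intro closed_Collect_le continuous_intros)
    then have "compact L"
      unfolding L_def using \<open>compact K\<close> by (rule compact_Int_closed [rotated])
    have "\<exists>r>0. \<forall>\<^sub>F k in sequentially. ball z r \<inter> closure (pseudospectrum \<epsilon> (Tk k)) = {}"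
      if "z \<in> L" for z
    proof -
      have "z \<in> K" "z \<notin> A"
        using that \<open>0 < \<delta>\<close> by (auto simp: L_def)
      then have "z \<notin> closure (pseudospectrum \<epsilon> T)" by (simp add: A_def)
      note not_in_closure_pseudospectrum [OF lin(1) \<open>0 < \<epsilon>\<close> assms(9) this]
      then show ?thesis by (rule eventually_disjoint_pseudospectrum [OF lin z0 lim])
    qed
    then obtain r where r: "\<And>z. z \<in> L \<Longrightarrow> 0 < r z"
      "\<And>z. z \<in> L \<Longrightarrow> \<forall>\<^sub>F k in sequentially. ball z (r z) \<inter> closure (pseudospectrum \<epsilon> (Tk k)) = {}"
      by metis
    have "L \<subseteq> (\<Union>z\<in>L. ball z (r z))" using r(1) by force
    then obtain F where F: "F \<subseteq> L" "finite F" "L \<subseteq> (\<Union>z\<in>F. ball z (r z))"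
      using compactE_image [OF \<open>compact L\<close>, of L "\<lambda>z. ball z (r z)"] by auto
    have "\<forall>\<^sub>F k in sequentially. \<forall>z\<in>F. ball z (r z) \<inter> closure (pseudospectrum \<epsilon> (Tk k)) = {}"
      using F r(2) by (intro eventually_ball_finite) auto
    then show ?thesis
    proof eventually_elim
      case (elim k)
      show ?case
      proof
        fix z assume z: "z \<in> B k"
        then have "z \<notin> L" using elim F(3) unfolding B_def by blast
        then show "infdist z A \<le> \<delta>" using z by (auto simp: L_def B_def)
      qed
    qed
  qed
  have lower: "\<forall>\<^sub>F k in sequentially. B k \<noteq> {} \<and> (\<forall>z\<in>A. infdist z (B k) \<le> \<delta>)" if "0 < \<delta>" for \<delta>
  proof -
    \<comment> \<open>By hypothesis i) the centres can be taken in the pseudospectrum and in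
      \<open>K\<close> at once. Hence finitely many of them eventually lie in \<open>B k\<close>,
      and not merely near \<open>K\<close>.\<close>
    have "A \<subseteq> (\<Union>z\<in>pseudospectrum \<epsilon> T \<inter> K. ball z \<delta>)"
      unfolding A(1) using \<open>0 < \<delta>\<close> by (auto simp: closure_approachable)
    then obtain F where F: "F \<subseteq> pseudospectrum \<epsilon> T \<inter> K" "finite F" "A \<subseteq> (\<Union>z\<in>F. ball z \<delta>)"
      using compactE_image [OF \<open>compact A\<close>, of "pseudospectrum \<epsilon> T \<inter> K" "\<lambda>z. ball z \<delta>"] by auto
    have "\<forall>\<^sub>F k in sequentially. \<forall>z\<in>F. z \<in> pseudospectrum \<epsilon> (Tk k)"
      using F eventually_in_pseudospectrum [OF lin z0 lim] by (intro eventually_ball_finite) auto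
    then show ?thesis
    proof eventually_elim
      case (elim k)
      then have FB: "F \<subseteq> B k" using F(1) closure_subset by (fastforce simp: B_def)
      \<comment> \<open>The non-emptiness of \<open>A\<close> passes through the finite cover to
        \<open>B k\<close>.\<close>
      moreover have "F \<noteq> {}" using F(3) A(2) by auto
      moreover have "infdist z (B k) \<le> \<delta>" if "z \<in> A" for z
      proof -
        obtain w where "w \<in> F" "z \<in> ball w \<delta>" using F(3) \<open>z \<in> A\<close> by blast
        then show ?thesis
          using infdist_le [of w "B k" z] FB by (auto simp: dist_commute)
      qed
      ultimately show ?case by auto
    qed
  qed
  have "(\<lambda>k. hausdorff_dist (B k) A) \<longlonglongrightarrow> 0"
  proof (rule tendstoI)
    fix \<delta> :: real assume "0 < \<delta>"
    \<comment> \<open>Halving turns the non-strict bounds into the strict inequality required for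
      convergence.\<close>
    then have "0 < \<delta> / 2" by simp
    from upper [OF this] lower [OF this]
    show "\<forall>\<^sub>F k in sequentially. dist (hausdorff_dist (B k) A) 0 < \<delta>"
    proof eventually_elim
      case (elim k)
      then show ?case
        using hausdorff_dist_bounds [of "B k" A "\<delta> / 2"] A(2) \<open>0 < \<delta>\<close> by force
    qed
  qed
  moreover have "\<forall>\<^sub>F k in sequentially. B k \<noteq> {}"
    using lower [of 1] by (auto elim: eventually_mono)
  ultimately show ?thesis by (simp add: A_def B_def)
qed

end
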